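(* Let $n\ge 2$. Let $V$ be the $K$-vector space with basis $\{v_i^r : 1\le i,r\le n\}$ and define endomorphisms $\mathbf{E},\mathbf{T}$ of $V^{\otimes 2}$ by $$\mathbf{E}(v_i^r\otimes v_j^s)=\begin{cases}0 & r\ne s\\ v_i^r\otimes v_j^s & r=s\end{cases}$$ $$\mathbf{T}(v_i^r\otimes v_j^s)=\begin{cases}-v_j^s\otimes v_i^r & r\neq s\\ -v_i^r\otimes v_j^s & r=s,\ i=j\\ (u-1)\,v_i^r\otimes v_j^s+\sqrt{u}\,v_j^s\otimes v_i^r & r=s,\ i<j\\ \sqrt{u}\,v_j^s\otimes v_i^r & r=s,\ i>j.\end{cases}$$ For $1\le i\le n-1$ let $\mathbf{E}_i$ (respectively $\mathbf{T}_i$) be the endomorphism of $V^{\otimes n}$ acting as $\mathbf{E}$ (respectively $\mathbf{T}$) on the tensor factors $i$ and $i+1$ and as the identity on the other factors. Then the assignment $E_i\mapsto \mathbf{E}_i$, $T_i\mapsto\mathbf{T}_i$ defines a representation $\mathcal{J}_n$ of the algebra $\mathcal{E}_n$ on $V^{\otimes n}$.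
   Context: $K=\mathbb{C}(\sqrt u)$ is the field of rational functions in the variable $\sqrt u$, and $u=(\sqrt u)^2$. All algebras are unital associative $K$-algebras. The algebra of braids and ties $\mathcal{E}_n=\mathcal{E}_n(u)$ is the algebra generated by $1,T_1,\dots,T_{n-1},E_1,\dots,E_{n-1}$ with relations: $T_iT_j=T_jT_i$ for $|i-j|>1$; $T_iT_jT_i=T_jT_iT_j$ for $|i-j|=1$; $T_i^2=1+(u-1)E_i(1+T_i)$ for all $i$; $E_iE_j=E_jE_i$ for all $i,j$; $E_i^2=E_i$ for all $i$; $E_iT_j=T_jE_i$ for $|i-j|>1$; $E_iT_i=T_iE_i$ for all $i$; $E_iE_jT_i=T_iE_iE_j=E_jT_iE_j$ for $|i-j|=1$; $E_iT_jT_i=T_jT_iE_j$ for $|i-j|=1$. *)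

theory Defs
  imports
    "HOL-Computational_Algebra.Fraction_Field"
    "HOL-Computational_Algebra.Polynomial"
    "HOL-Library.Poly_Mapping"
    "HOL-Algebra.QuotRing"
    "HOL-Algebra.Module"
begin

section \<open>The base field\<close>

text \<open>The indeterminate of the polynomial ring plays the role of the square root of \<open>u\<close>.\<close>

type_synonym K = "complex poly fract"

definition sqrt_u :: K where
  "sqrt_u = Fraction_Field.Fract [:0, 1:] 1"

definition u :: K where
  "u = sqrt_u ^ 2"


section \<open>Free algebras\<close>

text \<open>
  Words under concatenation form a monoid, so the convolution product of
  \<^theory>\<open>HOL-Library.Poly_Mapping\<close> turns finitely supported functions on words into the
  free associative unital algebra.
\<close>

instantiation list :: (type) monoid_add
begin

definition zero_list :: "'a list" where
  "zero_list = []"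

definition plus_list :: "'a list \<Rightarrow> 'a list \<Rightarrow> 'a list" where
  "plus_list = append"

instance
  by standard (simp_all add: zero_list_def plus_list_def)

end

type_synonym 'a ncpoly = "'a list \<Rightarrow>\<^sub>0 K"

definition of_word :: "'a list \<Rightarrow> 'a ncpoly" where
  "of_word w = Poly_Mapping.single w 1"

definition scale :: "K \<Rightarrow> 'a ncpoly \<Rightarrow> 'a ncpoly" where
  "scale c x = Poly_Mapping.map ((*) c) x"

definition free_algebra :: "'a set \<Rightarrow> (K, 'a ncpoly) module" where
  "free_algebra X =
    \<lparr>carrier = {x. Poly_Mapping.keys x \<subseteq> lists X},
     mult = (*), one = 1, zero = 0, add = (+), smult = scale\<rparr>"

text \<open>Quotient of an algebra by a two-sided ideal; scalars act on cosets as products do in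
  \<^const>\<open>rcoset_mult\<close>.\<close>

definition quotient_algebra :: "(K, 'a) module \<Rightarrow> 'a set \<Rightarrow> (K, 'a set) module" where
  "quotient_algebra A I =
    ring.extend (A Quot I)
      (module.fields (\<lambda>c X. \<Union>x\<in>X. I +>\<^bsub>A\<^esub> (c \<odot>\<^bsub>A\<^esub> x)))"

definition algebra_hom :: "(K, 'a) module \<Rightarrow> (K, 'b) module \<Rightarrow> ('a \<Rightarrow> 'b) set" where
  "algebra_hom A B =
    {h \<in> ring_hom A B. \<forall>c. \<forall>x\<in>carrier A. h (c \<odot>\<^bsub>A\<^esub> x) = c \<odot>\<^bsub>B\<^esub> h x}"


section \<open>The algebra of braids and ties\<close>

datatype bt_gen = TGen nat | EGen nat

definition bt_gens :: "nat \<Rightarrow> bt_gen set" where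
  "bt_gens n = TGen ` {1..<n} \<union> EGen ` {1..<n}"

abbreviation T :: "nat \<Rightarrow> bt_gen ncpoly" where
  "T i \<equiv> of_word [TGen i]"

abbreviation E :: "nat \<Rightarrow> bt_gen ncpoly" where
  "E i \<equiv> of_word [EGen i]"

abbreviation far :: "nat \<Rightarrow> nat \<Rightarrow> bool" where
  "far i j \<equiv> \<bar>int i - int j\<bar> > 1"

abbreviation adjacent :: "nat \<Rightarrow> nat \<Rightarrow> bool" where
  "adjacent i j \<equiv> \<bar>int i - int j\<bar> = 1"

inductive_set bt_relations :: "nat \<Rightarrow> (bt_gen ncpoly \<times> bt_gen ncpoly) set" for n :: nat where
  TT_far: "\<lbrakk>i \<in> {1..<n}; j \<in> {1..<n}; far i j\<rbrakk>
    \<Longrightarrow> (T i * T j, T j * T i) \<in> bt_relations n"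
| TTT: "\<lbrakk>i \<in> {1..<n}; j \<in> {1..<n}; adjacent i j\<rbrakk>
    \<Longrightarrow> (T i * T j * T i, T j * T i * T j) \<in> bt_relations n"
| T_square: "i \<in> {1..<n}
    \<Longrightarrow> (T i ^ 2, 1 + scale (u - 1) (E i * (1 + T i))) \<in> bt_relations n"
| EE: "\<lbrakk>i \<in> {1..<n}; j \<in> {1..<n}\<rbrakk>
    \<Longrightarrow> (E i * E j, E j * E i) \<in> bt_relations n"
| E_square: "i \<in> {1..<n}
    \<Longrightarrow> (E i ^ 2, E i) \<in> bt_relations n"
| ET_far: "\<lbrakk>i \<in> {1..<n}; j \<in> {1..<n}; far i j\<rbrakk>
    \<Longrightarrow> (E i * T j, T j * E i) \<in> bt_relations n"
| ET: "i \<in> {1..<n}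
    \<Longrightarrow> (E i * T i, T i * E i) \<in> bt_relations n"
| EET: "\<lbrakk>i \<in> {1..<n}; j \<in> {1..<n}; adjacent i j\<rbrakk>
    \<Longrightarrow> (E i * E j * T i, T i * E i * E j) \<in> bt_relations n"
| ETE: "\<lbrakk>i \<in> {1..<n}; j \<in> {1..<n}; adjacent i j\<rbrakk>
    \<Longrightarrow> (T i * E i * E j, E j * T i * E j) \<in> bt_relations n"
| ETT: "\<lbrakk>i \<in> {1..<n}; j \<in> {1..<n}; adjacent i j\<rbrakk>
    \<Longrightarrow> (E i * T j * T i, T j * T i * E j) \<in> bt_relations n"

definition bt_ideal :: "nat \<Rightarrow> bt_gen ncpoly set" where
  "bt_ideal n = Idl\<^bsub>free_algebra (bt_gens n)\<^esub> {x - y | x y. (x, y) \<in> bt_relations n}"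

definition bt_algebra :: "nat \<Rightarrow> (K, bt_gen ncpoly set) module" where
  "bt_algebra n = quotient_algebra (free_algebra (bt_gens n)) (bt_ideal n)"

definition bt_T :: "nat \<Rightarrow> nat \<Rightarrow> bt_gen ncpoly set" where
  "bt_T n i = bt_ideal n +>\<^bsub>free_algebra (bt_gens n)\<^esub> T i"

definition bt_E :: "nat \<Rightarrow> nat \<Rightarrow> bt_gen ncpoly set" where
  "bt_E n i = bt_ideal n +>\<^bsub>free_algebra (bt_gens n)\<^esub> E i"


section \<open>Tensor powers and their endomorphisms\<close>

text \<open>
  The pair \<open>(i, r)\<close> indexes the basis vector \<open>v\<close> with lower index \<open>i\<close> and upper index \<open>r\<close>.
  For a vector space \<open>V\<close> with a given basis, the tensor algebra of \<open>V\<close> is the free algebra on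
  that basis: the product \<open>*\<close> of \<^typ>\<open>(nat \<times> nat) ncpoly\<close> is the tensor product, the word
  \<open>[b1, ..., bm]\<close> stands for the pure tensor of the basis vectors \<open>b1, ..., bm\<close>, and the
  \<open>m\<close>-th tensor power of \<open>V\<close> is the span of the words of length \<open>m\<close>.
\<close>

definition V_basis :: "nat \<Rightarrow> (nat \<times> nat) set" where
  "V_basis n = {1..n} \<times> {1..n}"

definition v :: "nat \<Rightarrow> nat \<Rightarrow> (nat \<times> nat) ncpoly" where
  "v i r = of_word [(i, r)]"

definition tensor_power :: "'a set \<Rightarrow> nat \<Rightarrow> 'a ncpoly set" where
  "tensor_power B m = {x. Poly_Mapping.keys x \<subseteq> {w \<in> lists B. length w = m}}"

definition linear_extension :: "('a list \<Rightarrow> 'b ncpoly) \<Rightarrow> 'a ncpoly \<Rightarrow> 'b ncpoly" where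
  "linear_extension f x = (\<Sum>w\<in>Poly_Mapping.keys x. scale (Poly_Mapping.lookup x w) (f w))"

text \<open>Endomorphisms of a subspace \<open>W\<close> are extensional functions, so that equality of
  endomorphisms is equality on \<open>W\<close>.\<close>

definition End_algebra :: "'a ncpoly set \<Rightarrow> (K, 'a ncpoly \<Rightarrow> 'a ncpoly) module" where
  "End_algebra W =
    \<lparr>carrier = {f \<in> W \<rightarrow>\<^sub>E W. (\<forall>x\<in>W. \<forall>y\<in>W. f (x + y) = f x + f y)
                         \<and> (\<forall>c. \<forall>x\<in>W. f (scale c x) = scale c (f x))},
     mult = compose W,
     one = (\<lambda>x\<in>W. x),
     zero = (\<lambda>x\<in>W. 0),
     add = (\<lambda>f g. \<lambda>x\<in>W. f x + g x),
     smult = (\<lambda>c f. \<lambda>x\<in>W. scale c (f x))\<rparr>"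

text \<open>The operators on the tensor square; words of length other than two are irrelevant.\<close>

definition op_E :: "(nat \<times> nat) ncpoly \<Rightarrow> (nat \<times> nat) ncpoly" where
  "op_E = linear_extension (\<lambda>w. case w of
      [(i, r), (j, s)] \<Rightarrow> (if r \<noteq> s then 0 else v i r * v j s)
    | _ \<Rightarrow> 0)"

definition op_T :: "(nat \<times> nat) ncpoly \<Rightarrow> (nat \<times> nat) ncpoly" where
  "op_T = linear_extension (\<lambda>w. case w of
      [(i, r), (j, s)] \<Rightarrow>
        (if r \<noteq> s then - (v j s * v i r)
         else if i = j then - (v i r * v j s)
         else if i < j then scale (u - 1) (v i r * v j s) + scale sqrt_u (v j s * v i r)
         else scale sqrt_u (v j s * v i r))
    | _ \<Rightarrow> 0)"

text \<open>The operator \<open>F\<close> on the tensor factors \<open>i\<close> and \<open>i + 1\<close> (counted from 1) of the \<open>n\<close>-th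
  tensor power, and the identity on the others.\<close>

definition at_factors ::
  "nat \<Rightarrow> nat \<Rightarrow> ((nat \<times> nat) ncpoly \<Rightarrow> (nat \<times> nat) ncpoly)
    \<Rightarrow> (nat \<times> nat) ncpoly \<Rightarrow> (nat \<times> nat) ncpoly" where
  "at_factors n i F = restrict
    (linear_extension (\<lambda>w. of_word (take (i - 1) w)
                          * F (of_word [w ! (i - 1), w ! i])
                          * of_word (drop (i + 1) w)))
    (tensor_power (V_basis n) n)"

end

theory Submission
  imports Defs
begin

text \<open>
  A word of generators acts on the tensor algebra by composition, which extends linearly to a
  homomorphism from the free algebra to the endomorphisms of the tensor power. It factors through
  the quotient as soon as it respects the defining relations, and these need only be tested on
  pure tensors of basis vectors, of which each relation moves at most four factors. There
  \<open>E\<close> is diagonal and \<open>T\<close> is a combination of the identity and the flip, so every relation becomes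
  a few scalar identities between coefficients, checked by comparing the indices of the
  basis vectors. Uniqueness holds because the cosets of the generators generate the quotient.
\<close>


section \<open>Free algebras as vector spaces\<close>

lemma lookup_scale: "Poly_Mapping.lookup (scale c x) w = c * Poly_Mapping.lookup x w"
  by (simp add: scale_def Poly_Mapping.map.rep_eq when_def)

interpretation nc: vector_space "scale :: K \<Rightarrow> 'a ncpoly \<Rightarrow> 'a ncpoly"
  by standard (auto intro!: poly_mapping_eqI simp: lookup_scale lookup_add algebra_simps)

interpretation nc_pair: vector_space_pair "scale :: K \<Rightarrow> 'a ncpoly \<Rightarrow> 'a ncpoly"
  "scale :: K \<Rightarrow> 'b ncpoly \<Rightarrow> 'b ncpoly"
  by unfold_locales

abbreviation nc_linear :: "('a ncpoly \<Rightarrow> 'b ncpoly) \<Rightarrow> bool" where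
  "nc_linear \<equiv> Vector_Spaces.linear scale scale"

lemma nc_linearI:
  assumes "\<And>x y. f (x + y) = f x + f y" "\<And>c x. f (scale c x) = scale c (f x)"
  shows "nc_linear f"
  unfolding Vector_Spaces.linear_iff
  by (intro conjI nc.vector_space_axioms allI assms)

lemma nc_linear_comp: "nc_linear f \<Longrightarrow> nc_linear g \<Longrightarrow> nc_linear (\<lambda>x. f (g x))"
  using Vector_Spaces.linear_compose [of scale scale g scale f] by (simp add: o_def)

lemma ncpoly_eq_sum:
  "x = (\<Sum>w\<in>Poly_Mapping.keys x. scale (Poly_Mapping.lookup x w) (of_word w))"
  by (rule poly_mapping_eqI)
    (simp add: lookup_sum lookup_scale of_word_def lookup_single when_def in_keys_iff
      if_distrib [of "(*) _"] sum.delta cong: if_cong)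

lemma keys_of_word [simp]: "Poly_Mapping.keys (of_word w) = {w}"
  by (simp add: of_word_def)

lemma lookup_of_word: "Poly_Mapping.lookup (of_word w) w' = (if w = w' then 1 else 0)"
  by (simp add: of_word_def lookup_single when_def)

lemma of_word_mult: "of_word w * of_word w' = of_word (w @ w')"
  by (simp add: of_word_def mult_single plus_list_def)

lemma of_word_Nil: "of_word [] = 1"
  by (simp add: of_word_def zero_list_def [symmetric])

text \<open>Carriers of free algebras and tensor powers are both given by conditions on supports.
  Read as membership in a span of words, such a condition admits span induction and the comparison
  of linear maps on a spanning set.\<close>

lemma keys_subset_iff_span:
  "Poly_Mapping.keys x \<subseteq> S \<longleftrightarrow> x \<in> nc.span (of_word ` S)"
proof
  assume *: "Poly_Mapping.keys x \<subseteq> S"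
  have "(\<Sum>w\<in>Poly_Mapping.keys x. scale (Poly_Mapping.lookup x w) (of_word w))
      \<in> nc.span (of_word ` S)"
    using * by (intro nc.span_sum nc.span_scale nc.span_base) auto
  thus "x \<in> nc.span (of_word ` S)"
    by (simp add: ncpoly_eq_sum [symmetric])
next
  have "nc.subspace {x. Poly_Mapping.keys x \<subseteq> S}"
  proof (rule nc.subspaceI, goal_cases)
    case (2 x y)
    thus ?case using keys_add [of x y] by auto
  qed (auto simp: in_keys_iff lookup_scale subset_iff)
  hence "nc.span (of_word ` S) \<subseteq> {x. Poly_Mapping.keys x \<subseteq> S}"
    by (intro nc.span_minimal) auto
  thus "x \<in> nc.span (of_word ` S) \<Longrightarrow> Poly_Mapping.keys x \<subseteq> S"
    by auto
qed

lemma nc_linear_eqI: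
  assumes "nc_linear f" "nc_linear g" "\<And>w. w \<in> S \<Longrightarrow> f (of_word w) = g (of_word w)"
    and "Poly_Mapping.keys x \<subseteq> S"
  shows "f x = g x"
  using nc_pair.linear_eq_on_span [OF assms(1,2), of "of_word ` S"] assms(3,4)
  by (auto simp: keys_subset_iff_span)

lemma linear_extension_of_word [simp]: "linear_extension f (of_word w) = f w"
  by (simp add: linear_extension_def lookup_of_word)

text \<open>Cancellation may shrink the support of a sum. Summing over a fixed finite superset
  removes this dependence, and linearity can be read off term by term.\<close>

lemma linear_extension_superset:
  assumes "finite S" "Poly_Mapping.keys x \<subseteq> S"
  shows "linear_extension f x = (\<Sum>w\<in>S. scale (Poly_Mapping.lookup x w) (f w))"
  unfolding linear_extension_def using assms
  by (intro sum.mono_neutral_left) (auto simp: in_keys_iff)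

lemma nc_linear_linear_extension [intro, simp]: "nc_linear (linear_extension f)"
proof (rule nc_linearI)
  fix x y :: "'a ncpoly"
  let ?S = "Poly_Mapping.keys x \<union> Poly_Mapping.keys y"
  show "linear_extension f (x + y) = linear_extension f x + linear_extension f y"
    by (subst (1 2 3) linear_extension_superset [where S = ?S])
      (use keys_add [of x y] in \<open>auto simp: lookup_add nc.scale_left_distrib sum.distrib\<close>)
next
  fix c and x :: "'a ncpoly"
  have "Poly_Mapping.keys (scale c x) \<subseteq> Poly_Mapping.keys x"
    by (auto simp: in_keys_iff lookup_scale)
  thus "linear_extension f (scale c x) = scale c (linear_extension f x)"
    by (subst (1 2) linear_extension_superset [where S = "Poly_Mapping.keys x"])
      (auto simp: lookup_scale nc.scale_sum_right)
qed

lemma scale_of_word: "scale c (of_word w) = Poly_Mapping.single w c"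
  by (rule poly_mapping_eqI) (simp add: lookup_scale lookup_of_word lookup_single when_def)

text \<open>A scalar is a multiple of the empty word, the unit of the algebra. Compatibility of
  scaling with products thus becomes associativity for the left factor and centrality of the empty
  word for the right one.\<close>

lemma scale_eq_mult: "scale c x = Poly_Mapping.single [] c * x"
proof -
  have x: "x = (\<Sum>w\<in>Poly_Mapping.keys x. Poly_Mapping.single w (Poly_Mapping.lookup x w))"
    using ncpoly_eq_sum [of x] by (simp only: scale_of_word)
  have "scale c (Poly_Mapping.single w a) = Poly_Mapping.single [] c * Poly_Mapping.single w a"
    for w :: "'a list" and a
    by (rule poly_mapping_eqI)
      (simp add: mult_single plus_list_def lookup_scale lookup_single mult_when)
  hence "scale c (\<Sum>w\<in>Poly_Mapping.keys x. Poly_Mapping.single w (Poly_Mapping.lookup x w))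
    = Poly_Mapping.single [] c * (\<Sum>w\<in>Poly_Mapping.keys x. Poly_Mapping.single w (Poly_Mapping.lookup x w))"
    by (simp only: nc.scale_sum_right sum_distrib_left)
  thus ?thesis
    by (simp only: x [symmetric])
qed

lemma scale_mult_left: "scale c x * y = scale c (x * y)"
  by (simp add: scale_eq_mult mult.assoc)

lemma nc_linear_mult_left: "nc_linear (\<lambda>x. x * y)"
  by (rule nc_linearI) (auto simp: algebra_simps scale_mult_left)

lemma of_word_mult_scale: "of_word w * scale c y = scale c (of_word w * y)"
proof -
  have "Poly_Mapping.single w 1 * Poly_Mapping.single [] c
      = Poly_Mapping.single [] c * Poly_Mapping.single w (1 :: K)"
    by (simp add: mult_single plus_list_def)
  thus ?thesis
    by (simp add: scale_eq_mult of_word_def flip: mult.assoc)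
qed

lemma scale_mult_right: "x * scale c y = scale c (x * y)"
proof (rule nc_linear_eqI [of "\<lambda>x. x * scale c y" "\<lambda>x. scale c (x * y)" UNIV])
  show "nc_linear (\<lambda>x. scale c (x * y))"
    by (rule nc_linearI) (auto simp: algebra_simps scale_mult_left nc.scale_right_distrib)
qed (auto simp: nc_linear_mult_left of_word_mult_scale)

lemma nc_linear_mult_right: "nc_linear (\<lambda>y. x * y)"
  by (rule nc_linearI) (auto simp: algebra_simps scale_mult_right)


section \<open>Homomorphisms out of a free algebra\<close>

lemma free_algebra_sel [simp]:
  "carrier (free_algebra X) = {x. Poly_Mapping.keys x \<subseteq> lists X}"
  "mult (free_algebra X) = (*)" "one (free_algebra X) = 1"
  "zero (free_algebra X) = 0" "add (free_algebra X) = (+)" "smult (free_algebra X) = scale"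
  by (simp_all add: free_algebra_def)

lemma subspace_words: "nc.subspace {x. Poly_Mapping.keys x \<subseteq> S}"
proof -
  have "{x. Poly_Mapping.keys x \<subseteq> S} = nc.span (of_word ` S)"
    by (auto simp: keys_subset_iff_span)
  thus ?thesis by simp
qed

lemma keys_scale_subset: "Poly_Mapping.keys x \<subseteq> S \<Longrightarrow> Poly_Mapping.keys (scale c x) \<subseteq> S"
  using nc.subspace_scale [OF subspace_words] by blast

lemma keys_add_subset:
  fixes x y :: "'a ncpoly"
  shows "Poly_Mapping.keys x \<subseteq> S \<Longrightarrow> Poly_Mapping.keys y \<subseteq> S \<Longrightarrow> Poly_Mapping.keys (x + y) \<subseteq> S"
  using keys_add [of x y] by blast

lemma keys_mult_lists:
  fixes x y :: "'a ncpoly"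
  assumes "Poly_Mapping.keys x \<subseteq> lists X" "Poly_Mapping.keys y \<subseteq> lists X"
  shows "Poly_Mapping.keys (x * y) \<subseteq> lists X"
proof
  fix w assume "w \<in> Poly_Mapping.keys (x * y)"
  then obtain a b where "w = a @ b" "a \<in> Poly_Mapping.keys x" "b \<in> Poly_Mapping.keys y"
    using keys_mult [of x y] by (auto simp: plus_list_def)
  thus "w \<in> lists X"
    using assms by (simp add: subset_iff)
qed

lemma ring_free_algebra: "ring (free_algebra X)"
proof (rule ringI)
  show "abelian_group (free_algebra X)"
  proof (rule abelian_groupI)
    fix x assume "x \<in> carrier (free_algebra X)"
    thus "\<exists>y\<in>carrier (free_algebra X). y \<oplus>\<^bsub>free_algebra X\<^esub> x = \<zero>\<^bsub>free_algebra X\<^esub>"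
      by (intro bexI [of _ "- x"]) auto
  qed (auto simp: algebra_simps keys_add_subset)
  show "Group.monoid (free_algebra X)"
    by (rule monoidI) (simp_all add: mult.assoc zero_list_def keys_mult_lists)
qed (auto simp: algebra_simps)

lemma algebra_hom_free_eqI:
  assumes h: "h \<in> algebra_hom (free_algebra X) A" and h': "h' \<in> algebra_hom (free_algebra X) A"
    and gen: "\<And>g. g \<in> X \<Longrightarrow> h (of_word [g]) = h' (of_word [g])"
    and x: "x \<in> carrier (free_algebra X)"
  shows "h x = h' x"
proof -
  note hs = h [unfolded algebra_hom_def ring_hom_def, simplified]
    h' [unfolded algebra_hom_def ring_hom_def, simplified]
  have words: "h (of_word w) = h' (of_word w)" if "w \<in> lists X" for w
    using that
  proof (induction w)
    case Nil
    show ?case using hs by (simp add: of_word_Nil)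
  next
    case (Cons g w)
    have "of_word (g # w) = of_word [g] * of_word w"
      by (simp add: of_word_mult)
    with Cons gen [OF Cons(1)] hs show ?case
      by simp
  qed
  \<comment> \<open>No additive group laws are available in \<open>A\<close>, so the common value at
    0 comes from the scalar action: 0 is 0 times the unit, and both maps preserve the unit.\<close>
  have "H 0 = 0 \<odot>\<^bsub>A\<^esub> \<one>\<^bsub>A\<^esub>" if "H \<in> algebra_hom (free_algebra X) A" for H
  proof -
    have "H (scale 0 1) = 0 \<odot>\<^bsub>A\<^esub> H 1"
      using that unfolding algebra_hom_def by (simp add: zero_list_def del: nc.scale_zero_left)
    thus ?thesis
      using that by (simp add: algebra_hom_def ring_hom_def)
  qed
  from this [OF h] this [OF h'] have "h 0 = h' 0"
    by simp
  \<comment> \<open>The support condition is carried along because the maps are known to be additive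
    only on the carrier.\<close>
  have "Poly_Mapping.keys x \<subseteq> lists X \<and> h x = h' x" if "x \<in> nc.span (of_word ` lists X)"
    using that
  proof (induction rule: nc.span_induct_alt)
    case base
    show ?case using \<open>h 0 = h' 0\<close> by simp
  next
    case (step c y z)
    then obtain w where w: "w \<in> lists X" "y = of_word w" by auto
    have y: "Poly_Mapping.keys y \<subseteq> lists X"
      using w by simp
    note keys = y keys_scale_subset [OF y, of c]
    have "H (scale c y + z) = (c \<odot>\<^bsub>A\<^esub> H y) \<oplus>\<^bsub>A\<^esub> H z"
      if "H \<in> algebra_hom (free_algebra X) A" for H
      using that keys step(2) by (simp add: algebra_hom_def ring_hom_def)
    from this [OF h] this [OF h'] show ?case
      using words [OF w(1)] w(2) step(2) keys by (simp add: keys_add_subset)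
  qed
  thus ?thesis using x by (simp add: keys_subset_iff_span)
qed

section \<open>Endomorphism algebras and the action of words\<close>

lemma End_algebra_sel [simp]:
  "mult (End_algebra W) = compose W" "one (End_algebra W) = (\<lambda>x\<in>W. x)"
  "zero (End_algebra W) = (\<lambda>x\<in>W. 0)" "add (End_algebra W) = (\<lambda>f g. \<lambda>x\<in>W. f x + g x)"
  "smult (End_algebra W) = (\<lambda>c f. \<lambda>x\<in>W. scale c (f x))"
  by (simp_all add: End_algebra_def)

lemma carrier_End_algebra:
  "f \<in> carrier (End_algebra W) \<longleftrightarrow> f \<in> W \<rightarrow>\<^sub>E W \<and>
    (\<forall>x\<in>W. \<forall>y\<in>W. f (x + y) = f x + f y) \<and> (\<forall>c. \<forall>x\<in>W. f (scale c x) = scale c (f x))"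
  by (simp add: End_algebra_def)

lemma ring_End_algebra:
  assumes W: "nc.subspace W"
  shows "ring (End_algebra W)"
proof (rule ringI)
  note cl = nc.subspace_add [OF W] nc.subspace_scale [OF W] nc.subspace_0 [OF W]
    nc.subspace_neg [OF W]
  show "abelian_group (End_algebra W)"
  proof (rule abelian_groupI)
    fix f assume f: "f \<in> carrier (End_algebra W)"
    show "\<exists>g\<in>carrier (End_algebra W). g \<oplus>\<^bsub>End_algebra W\<^esub> f = \<zero>\<^bsub>End_algebra W\<^esub>"
      by (rule bexI [of _ "\<lambda>x\<in>W. - f x"])
        (use f in \<open>auto simp: carrier_End_algebra cl PiE_iff fun_eq_iff\<close>)
  qed (auto simp: carrier_End_algebra cl PiE_iff fun_eq_iff algebra_simps extensional_def nc.scale_right_distrib)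
  show "Group.monoid (End_algebra W)"
    by (rule monoidI)
      (auto simp: carrier_End_algebra cl PiE_iff fun_eq_iff compose_def extensional_def)
qed (auto simp: carrier_End_algebra nc.subspace_add [OF W] PiE_iff fun_eq_iff compose_def
    extensional_def)

text \<open>\<open>foldr\<close> lets the last letter act first, so concatenation becomes
  composition. The letters act on all of \<open>'b ncpoly\<close>; restricting to an invariant
  subspace only later keeps linearity free of membership conditions.\<close>

definition extend_rep ::
  "('g \<Rightarrow> 'b ncpoly \<Rightarrow> 'b ncpoly) \<Rightarrow> 'g ncpoly \<Rightarrow> 'b ncpoly \<Rightarrow> 'b ncpoly" where
  "extend_rep \<rho> x y = linear_extension (\<lambda>w. foldr \<rho> w y) x"

lemma extend_rep_of_word [simp]: "extend_rep \<rho> (of_word w) y = foldr \<rho> w y"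
  by (simp add: extend_rep_def)

lemma extend_rep_one [simp]: "extend_rep \<rho> 1 y = y"
  using extend_rep_of_word [of \<rho> "[]" y] by (simp add: of_word_Nil)

lemma nc_linear_extend_rep_left: "nc_linear (\<lambda>x. extend_rep \<rho> x y)"
  by (simp add: extend_rep_def)

lemma nc_linear_foldr: "(\<And>g. nc_linear (\<rho> g)) \<Longrightarrow> nc_linear (foldr \<rho> w)"
proof (induction w)
  case Nil
  show ?case by (auto intro: nc_linearI)
next
  case (Cons g w)
  thus ?case using nc_linear_comp [of "\<rho> g" "foldr \<rho> w"]
    by (simp add: o_def)
qed

lemma nc_linear_extend_rep_right:
  assumes "\<And>g. nc_linear (\<rho> g)"
  shows "nc_linear (extend_rep \<rho> x)"
  unfolding extend_rep_def linear_extension_def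
  using nc_linear_foldr [OF assms]
  by (intro nc_pair.linear_compose_sum ballI nc_pair.linear_compose_scale_right)

text \<open>Both sides are linear in \<open>x\<close> and in \<open>y\<close>, which reduces the
  claim to words, where it is \<open>foldr_append\<close>.\<close>

lemma extend_rep_mult:
  assumes "\<And>g. nc_linear (\<rho> g)"
  shows "extend_rep \<rho> (x * y) z = extend_rep \<rho> x (extend_rep \<rho> y z)"
proof -
  have foldr: "nc_linear (\<lambda>y. foldr \<rho> w y)" for w
    using nc_linear_foldr [of \<rho>, OF assms] by simp
  have word: "extend_rep \<rho> (of_word w * y) z = extend_rep \<rho> (of_word w) (extend_rep \<rho> y z)" for w
    by (rule nc_linear_eqI [of "\<lambda>y. extend_rep \<rho> (of_word w * y) z"
          "\<lambda>y. extend_rep \<rho> (of_word w) (extend_rep \<rho> y z)" UNIV])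
      (auto simp: of_word_mult foldr_append
        intro: nc_linear_comp [OF nc_linear_extend_rep_left nc_linear_mult_right]
          nc_linear_comp [OF foldr nc_linear_extend_rep_left])
  show ?thesis
    by (rule nc_linear_eqI [of "\<lambda>x. extend_rep \<rho> (x * y) z"
          "\<lambda>x. extend_rep \<rho> x (extend_rep \<rho> y z)" UNIV])
      (auto simp: word intro: nc_linear_extend_rep_left
        nc_linear_comp [OF nc_linear_extend_rep_left nc_linear_mult_left])
qed

lemma extend_rep_closed:
  assumes W: "nc.subspace W" and "\<And>g y. g \<in> X \<Longrightarrow> y \<in> W \<Longrightarrow> \<rho> g y \<in> W"
    and x: "Poly_Mapping.keys x \<subseteq> lists X" and y: "y \<in> W"
  shows "extend_rep \<rho> x y \<in> W"
proof -
  have "foldr \<rho> w y \<in> W" if "w \<in> lists X" for w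
    using that assms(2) y by (induction w) auto
  thus ?thesis
    unfolding extend_rep_def linear_extension_def using x
    by (intro nc.subspace_sum [OF W] nc.subspace_scale [OF W]) blast
qed

text \<open>Invariance of \<open>W\<close> under the letters makes the restricted maps compose like
  the unrestricted ones.\<close>

lemma extend_rep_algebra_hom:
  assumes "\<And>g. nc_linear (\<rho> g)" "nc.subspace W" "\<And>g y. g \<in> X \<Longrightarrow> y \<in> W \<Longrightarrow> \<rho> g y \<in> W"
  shows "(\<lambda>x. restrict (extend_rep \<rho> x) W) \<in> algebra_hom (free_algebra X) (End_algebra W)"
proof -
  note add = nc_pair.linear_add [OF nc_linear_extend_rep_left]
    nc_pair.linear_add [OF nc_linear_extend_rep_right [of \<rho>, OF assms(1)]]
  note scale = nc_pair.linear_scale [OF nc_linear_extend_rep_left]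
    nc_pair.linear_scale [OF nc_linear_extend_rep_right [of \<rho>, OF assms(1)]]
  note closed = extend_rep_closed [of W X \<rho>, OF assms(2,3)]
  show ?thesis
    unfolding algebra_hom_def ring_hom_def
    using nc.subspace_add [OF assms(2)] nc.subspace_scale [OF assms(2)]
    by (auto simp: carrier_End_algebra fun_eq_iff compose_def add scale closed
        extend_rep_mult [of \<rho>, OF assms(1)])
qed


section \<open>Quotients\<close>

lemma quotient_algebra_sel [simp]:
  "carrier (quotient_algebra A I) = carrier (A Quot I)"
  "mult (quotient_algebra A I) = mult (A Quot I)" "one (quotient_algebra A I) = one (A Quot I)"
  "zero (quotient_algebra A I) = zero (A Quot I)" "add (quotient_algebra A I) = add (A Quot I)"
  "smult (quotient_algebra A I) = (\<lambda>c X. \<Union>x\<in>X. I +>\<^bsub>A\<^esub> (c \<odot>\<^bsub>A\<^esub> x))"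
  by (simp_all add: quotient_algebra_def ring.extend_def module.fields_def)

context
  fixes X :: "'g set" and I :: "'g ncpoly set"
  assumes I: "ideal I (free_algebra X)"
begin

interpretation I: ideal I "free_algebra X"
  by (fact I)

text \<open>Scalars act as multiplication by elements of the algebra, so a ring ideal absorbs them
  and the quotient ring is a quotient of algebras.\<close>

lemma scale_ideal_closed: "x \<in> I \<Longrightarrow> scale c x \<in> I"
  using I.I_l_closed [of x "Poly_Mapping.single [] c"] by (simp add: scale_eq_mult)

lemma coset_eq: "I +>\<^bsub>free_algebra X\<^esub> x = {i + x | i. i \<in> I}"
  by (auto simp: a_r_coset_def')

text \<open>The union defining the scalar action on a coset runs over representatives, but all its
  members are one and the same coset because the ideal absorbs scalars.\<close>

lemma coset_algebra_hom:
  "(\<lambda>x. I +>\<^bsub>free_algebra X\<^esub> x) \<in> algebra_hom (free_algebra X) (quotient_algebra (free_algebra X) I)"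
proof -
  have "I +>\<^bsub>free_algebra X\<^esub> scale c x
      = (\<Union>y\<in>I +>\<^bsub>free_algebra X\<^esub> x. I +>\<^bsub>free_algebra X\<^esub> scale c y)"
    if x: "Poly_Mapping.keys x \<subseteq> lists X" for c x
  proof -
    have "I +>\<^bsub>free_algebra X\<^esub> scale c y = I +>\<^bsub>free_algebra X\<^esub> scale c x"
      if y: "y \<in> I +>\<^bsub>free_algebra X\<^esub> x" for y
    proof -
      obtain i where i: "i \<in> I" "y = i + x" using y by (auto simp: coset_eq)
      hence "scale c y \<in> I +>\<^bsub>free_algebra X\<^esub> scale c x"
        by (auto simp: coset_eq nc.scale_right_distrib intro: scale_ideal_closed)
      thus ?thesis
        using x by (intro I.a_repr_independence' [symmetric]) (auto dest: keys_scale_subset)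
    qed
    moreover have "x \<in> I +>\<^bsub>free_algebra X\<^esub> x"
      using x by (intro I.a_rcos_self) auto
    ultimately show ?thesis by blast
  qed
  thus ?thesis
    using I.rcos_ring_hom by (simp add: algebra_hom_def ring_hom_def)
qed

lemma carrier_quotient:
  "carrier (quotient_algebra (free_algebra X) I)
    = (\<lambda>x. I +>\<^bsub>free_algebra X\<^esub> x) ` carrier (free_algebra X)"
  by (auto simp: FactRing_def A_RCOSETS_def')

lemma quotient_universal:
  assumes h: "h \<in> algebra_hom (free_algebra X) B" and B: "ring B"
    and ker: "\<And>x. x \<in> I \<Longrightarrow> h x = \<zero>\<^bsub>B\<^esub>"
  shows "\<exists>J \<in> algebra_hom (quotient_algebra (free_algebra X) I) B
             \<inter> extensional (carrier (quotient_algebra (free_algebra X) I)).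
           \<forall>x\<in>carrier (free_algebra X). J (I +>\<^bsub>free_algebra X\<^esub> x) = h x"
proof -
  let ?Q = "quotient_algebra (free_algebra X) I"
  let ?p = "\<lambda>x. I +>\<^bsub>free_algebra X\<^esub> x"
  interpret B: ring B by (fact B)
  note hs = h [unfolded algebra_hom_def ring_hom_def, simplified]
  note ps = coset_algebra_hom [unfolded algebra_hom_def ring_hom_def, simplified]
  \<comment> \<open>\<open>J\<close> evaluates \<open>h\<close> at an arbitrary representative. Any
    two differ by an element of \<open>I\<close>, which \<open>h\<close> kills, so the choice does
    not matter.\<close>
  define J where "J = (\<lambda>Y\<in>carrier ?Q. h (SOME y. y \<in> Y))"
  have J: "J (?p x) = h x" if x: "x \<in> carrier (free_algebra X)" for x
  proof -
    have "x \<in> ?p x" using x by (intro I.a_rcos_self) auto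
    hence "(SOME y. y \<in> ?p x) \<in> ?p x" by (rule someI)
    then obtain i where i: "i \<in> I" "(SOME y. y \<in> ?p x) = i + x" by (auto simp: coset_eq)
    have "h (i + x) = h i \<oplus>\<^bsub>B\<^esub> h x"
      using hs x I.a_Hcarr [OF i(1)] by simp
    also have "\<dots> = h x"
      using hs x ker [OF i(1)] by (simp add: Pi_iff)
    finally show ?thesis
      using x i by (auto simp: J_def carrier_quotient simp del: quotient_algebra_sel)
  qed
  have "J \<in> algebra_hom ?Q B"
    unfolding algebra_hom_def ring_hom_def carrier_quotient
  proof (safe, goal_cases)
    case (1 _ x) thus ?case using J hs by auto
  next
    case (2 _ _ x y)
    have "?p x \<otimes>\<^bsub>?Q\<^esub> ?p y = ?p (x * y)" using ps 2 by simp
    thus ?case using J hs 2 keys_mult_lists [of x X y] by simp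
  next
    case (3 _ _ x y)
    have "?p x \<oplus>\<^bsub>?Q\<^esub> ?p y = ?p (x + y)" using ps 3 by simp
    thus ?case using J hs 3 keys_add_subset [of x "lists X" y] by simp
  next
    case 4
    have "\<one>\<^bsub>?Q\<^esub> = ?p 1" using ps by simp
    thus ?case using J [of 1] hs by (simp add: zero_list_def)
  next
    case (5 c _ x)
    have "c \<odot>\<^bsub>?Q\<^esub> ?p x = ?p (scale c x)" using ps 5 by simp
    thus ?case using J hs 5 keys_scale_subset [of x "lists X"] by simp
  qed
  moreover have "J \<in> extensional (carrier ?Q)" by (simp add: J_def)
  ultimately show ?thesis using J by blast
qed

text \<open>Composed with the projection, both maps become homomorphisms on the free algebra, which
  are determined by the letters; extensionality fixes the values off the carrier.\<close>

lemma quotient_hom_eqI: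
  assumes J: "J \<in> algebra_hom (quotient_algebra (free_algebra X) I) B
      \<inter> extensional (carrier (quotient_algebra (free_algebra X) I))"
    and J': "J' \<in> algebra_hom (quotient_algebra (free_algebra X) I) B
      \<inter> extensional (carrier (quotient_algebra (free_algebra X) I))"
    and gen: "\<And>g. g \<in> X \<Longrightarrow> J (I +>\<^bsub>free_algebra X\<^esub> of_word [g]) = J' (I +>\<^bsub>free_algebra X\<^esub> of_word [g])"
  shows "J = J'"
proof (rule extensionalityI)
  have comp: "(\<lambda>x. H (I +>\<^bsub>free_algebra X\<^esub> x)) \<in> algebra_hom (free_algebra X) B"
    if "H \<in> algebra_hom (quotient_algebra (free_algebra X) I) B" for H
    using that coset_algebra_hom
    by (simp add: algebra_hom_def ring_hom_def Pi_iff)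
  fix Y assume "Y \<in> carrier (quotient_algebra (free_algebra X) I)"
  then obtain x where "x \<in> carrier (free_algebra X)" "Y = I +>\<^bsub>free_algebra X\<^esub> x"
    by (auto simp: carrier_quotient simp del: quotient_algebra_sel)
  thus "J Y = J' Y"
    using algebra_hom_free_eqI [OF comp comp, of J J' x] J J' gen by auto
qed (use J J' in auto)

end


section \<open>The operators on the tensor power\<close>

text \<open>This is \<open>at_factors\<close> before restriction to the tensor power. It is linear
  everywhere, so composites expand without conditions on the domain.\<close>

definition act_at ::
  "nat \<Rightarrow> ((nat \<times> nat) ncpoly \<Rightarrow> (nat \<times> nat) ncpoly) \<Rightarrow> (nat \<times> nat) ncpoly \<Rightarrow> (nat \<times> nat) ncpoly"
  where "act_at i F = linear_extension (\<lambda>w. of_word (take (i - 1) w)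
      * F (of_word [w ! (i - 1), w ! i]) * of_word (drop (i + 1) w))"

lemma at_factors_eq: "at_factors n i F = restrict (act_at i F) (tensor_power (V_basis n) n)"
  by (simp add: at_factors_def act_at_def)

lemma nc_linear_act_at: "nc_linear (act_at i F)"
  by (simp add: act_at_def)

lemmas act_at_add = nc_pair.linear_add [OF nc_linear_act_at]
lemmas act_at_scale = nc_pair.linear_scale [OF nc_linear_act_at]

definition coeff_E :: "nat \<times> nat \<Rightarrow> nat \<times> nat \<Rightarrow> K" where
  "coeff_E p q = (if snd p = snd q then 1 else 0)"

text \<open>All four cases of \<^const>\<open>op_T\<close> have the shape
  \<open>p \<otimes> q \<mapsto> coeff_T p q \<cdot> p \<otimes> q + coeff_swap p q \<cdot> q \<otimes> p\<close>. For \<open>p = q\<close> this is ambiguous;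
  giving the whole coefficient to the first summand makes the identities below uniform.\<close>

definition coeff_T :: "nat \<times> nat \<Rightarrow> nat \<times> nat \<Rightarrow> K" where
  "coeff_T p q = (if snd p \<noteq> snd q then 0 else if fst p = fst q then - 1
    else if fst p < fst q then u - 1 else 0)"

definition coeff_swap :: "nat \<times> nat \<Rightarrow> nat \<times> nat \<Rightarrow> K" where
  "coeff_swap p q = (if snd p \<noteq> snd q then - 1 else if fst p = fst q then 0 else sqrt_u)"

lemma op_E_of_word: "op_E (of_word [p, q]) = scale (coeff_E p q) (of_word [p, q])"
  by (cases p; cases q) (simp add: op_E_def coeff_E_def v_def of_word_mult)

lemma op_T_of_word:
  "op_T (of_word [p, q])
    = scale (coeff_T p q) (of_word [p, q]) + scale (coeff_swap p q) (of_word [q, p])"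
  by (cases p; cases q)
    (simp add: op_T_def coeff_T_def coeff_swap_def v_def of_word_mult nc.scale_minus_left)

lemma act_E:
  assumes "length a = k"
  shows "act_at (Suc k) op_E (of_word (a @ p # q # b)) = scale (coeff_E p q) (of_word (a @ p # q # b))"
  using assms
  by (simp add: act_at_def nth_append op_E_of_word scale_mult_left scale_mult_right of_word_mult)

lemma act_T:
  assumes "length a = k"
  shows "act_at (Suc k) op_T (of_word (a @ p # q # b)) = scale (coeff_T p q) (of_word (a @ p # q # b))
    + scale (coeff_swap p q) (of_word (a @ q # p # b))"
  using assms
  by (simp add: act_at_def nth_append op_T_of_word distrib_left distrib_right
      scale_mult_left scale_mult_right of_word_mult)

text \<open>Moving \<open>p\<close> into the prefix gives the rule for the next pair, with the
  result written over the prefix \<open>a\<close> again, so that both neighbouring operators rewrite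
  words of one shape.\<close>

lemma act_E_Suc:
  assumes "length a = k"
  shows "act_at (Suc (Suc k)) op_E (of_word (a @ p # q # r # b))
    = scale (coeff_E q r) (of_word (a @ p # q # r # b))"
  using act_E [of "a @ [p]" "Suc k" q r b] assms by simp

lemma act_T_Suc:
  assumes "length a = k"
  shows "act_at (Suc (Suc k)) op_T (of_word (a @ p # q # r # b))
    = scale (coeff_T q r) (of_word (a @ p # q # r # b))
      + scale (coeff_swap q r) (of_word (a @ p # r # q # b))"
  using act_T [of "a @ [p]" "Suc k" q r b] assms by simp

section \<open>Cutting a word at the moved factors\<close>

lemma split_at_two:
  assumes "Suc k < length w"
  obtains a p q b where "w = a @ p # q # b" "length a = k"
proof -
  have "w = take k w @ w ! k # w ! Suc k # drop (Suc (Suc k)) w"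
    using assms by (simp add: id_take_nth_drop Cons_nth_drop_Suc)
  thus ?thesis using that assms by (metis Suc_lessD length_take min.absorb4)
qed

lemma split_at_three:
  assumes "Suc (Suc k) < length w"
  obtains a p q r b where "w = a @ p # q # r # b" "length a = k"
proof -
  obtain a p q b where w: "w = a @ p # q # b" "length a = k"
    using assms by (elim split_at_two [OF Suc_lessD])
  with assms that show ?thesis by (cases b) auto
qed

lemma split_far:
  assumes "i \<in> {1..<length w}" "j \<in> {1..<length w}" "i + 1 < j"
  obtains a p q m r s b where "w = a @ p # q # m @ r # s # b" "i = Suc (length a)"
    "j = Suc (length (a @ p # q # m))"
proof -
  obtain a p q b where w: "w = a @ p # q # b" "length a = i - 1"
    using assms by (auto intro: split_at_two [of "i - 1" w])
  \<comment> \<open>Exactly \<open>j - i - 2\<close> letters lie between the pair at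
    \<open>i\<close> and the pair at \<open>j\<close>.\<close>
  obtain m r s b' where "b = m @ r # s # b'" "length m = j - i - 2"
    using assms w by (auto intro: split_at_two [of "j - i - 2" b])
  with w assms show ?thesis by (intro that [of a p q m r s b']) auto
qed

lemmas act_linear = act_at_add act_at_scale

section \<open>The quadratic and braid relations\<close>

lemma sqrt_u_square: "sqrt_u * sqrt_u = u"
  by (simp add: u_def power2_eq_square)

text \<open>The coefficients of \<open>[p, q]\<close> and \<open>[q, p]\<close> in the quadratic
  relation. For distinct upper labels the operator is minus the flip; for equal labels and distinct
  lower indices, one of \<open>coeff_T p q\<close> and \<open>coeff_T q p\<close> is
  \<open>u - 1\<close> and the other 0.\<close>

lemma coeff_quadratic:
  "coeff_T p q * coeff_T p q + coeff_swap p q * coeff_swap q p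
    = 1 + (u - 1) * coeff_E p q * (1 + coeff_T p q)"
  "coeff_swap p q * (coeff_T p q + coeff_T q p) = (u - 1) * coeff_E p q * coeff_swap p q"
  by (auto simp: coeff_T_def coeff_E_def coeff_swap_def algebra_simps sqrt_u_square)

text \<open>The coefficients of \<open>[p, q, r]\<close>, \<open>[q, p, r]\<close> and
  \<open>[p, r, q]\<close> in the braid relation. The factor \<open>coeff_swap\<close> must stay: it
  vanishes for \<open>p = q\<close> in the second identity and for \<open>q = r\<close> in the
  third, where the remaining factors may differ.\<close>

lemma coeff_braid:
  "coeff_T p q * coeff_T p q * coeff_T q r + coeff_swap p q * coeff_swap q p * coeff_T p r
    = coeff_T q r * coeff_T q r * coeff_T p q + coeff_swap q r * coeff_swap r q * coeff_T p r"
  "coeff_swap p q * (coeff_T p q * coeff_T q r + coeff_T p r * coeff_T q p)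
    = coeff_swap p q * coeff_T q r * coeff_T p r"
  "coeff_swap q r * coeff_T p q * coeff_T p r
    = coeff_swap q r * (coeff_T q r * coeff_T p q + coeff_T p r * coeff_T r q)"
  by (auto simp: coeff_T_def coeff_swap_def algebra_simps sqrt_u_square)

text \<open>Variables in place of the coefficients keep their case distinctions folded; only
  commutative algebra remains. \<open>x\<close> and \<open>y\<close> stand for the entries of a word
  and of its flip.\<close>

lemma quadratic_identity:
  fixes x y :: "'a :: field"
  assumes "t * t + s * s' = 1 + c * e * (1 + t)" "s * (t + t') = c * e * s"
  shows "t * (t * x + s * y) + s * (t' * y + s' * x) = x + c * (e * x + (t * (e * x) + s * (e * y)))"
proof -
  have "t * (t * x + s * y) + s * (t' * y + s' * x) = (t * t + s * s') * x + (s * (t + t')) * y"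
    by (simp add: algebra_simps)
  thus ?thesis
    unfolding assms by (simp add: algebra_simps)
qed

lemma act_T_square:
  assumes "i \<in> {1..<length w}"
  shows "act_at i op_T (act_at i op_T (of_word w))
    = of_word w + scale (u - 1) (act_at i op_E (of_word w + act_at i op_T (of_word w)))"
proof -
  obtain a p q b where w: "w = a @ p # q # b" "length a = i - 1"
    using assms by (auto intro: split_at_two [of "i - 1" w])
  have i: "i = Suc (i - 1)" using assms by simp
  note acts = act_T [OF w(2), folded i] act_E [OF w(2), folded i]
  have E: "coeff_E q p = coeff_E p q" by (simp add: coeff_E_def)
  show ?thesis
    unfolding w(1)
  \<comment> \<open>Comparing entries at an arbitrary word turns the equation between vectors into
    one between scalars.\<close>
  proof (rule poly_mapping_eqI, simp only: acts act_linear lookup_add lookup_scale, goal_cases)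
    case (1 l)
    show ?case
      using coeff_quadratic [of p q] unfolding E by (rule quadratic_identity)
  qed
qed

text \<open>\<open>x1\<close> to \<open>x6\<close> belong to the arrangements pqr, qpr, prq, rpq,
  qrp, rqp. The coefficients of the last three agree by commutativity; those of the first three are
  the assumptions.\<close>

lemma braid_identity:
  fixes x1 x2 x3 x4 x5 x6 :: "'a :: field"
  assumes "tpq * tpq * tqr + spq * sqp * tpr = tqr * tqr * tpq + sqr * srq * tpr"
    and "spq * (tpq * tqr + tpr * tqp) = spq * tqr * tpr"
    and "sqr * tpq * tpr = sqr * (tqr * tpq + tpr * trq)"
  shows "tpq * (tqr * (tpq * x1 + spq * x2) + sqr * (tpr * x3 + spr * x4))
      + spq * (tpr * (tqp * x2 + sqp * x1) + spr * (tqr * x5 + sqr * x6))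
    = tqr * (tpq * (tqr * x1 + sqr * x3) + spq * (tpr * x2 + spr * x5))
      + sqr * (tpr * (trq * x3 + srq * x1) + spr * (tpq * x4 + spq * x6))"
proof -
  have "tpq * (tqr * (tpq * x1 + spq * x2) + sqr * (tpr * x3 + spr * x4))
      + spq * (tpr * (tqp * x2 + sqp * x1) + spr * (tqr * x5 + sqr * x6))
    = (tpq * tpq * tqr + spq * sqp * tpr) * x1 + (spq * (tpq * tqr + tpr * tqp)) * x2
      + (sqr * tpq * tpr) * x3 + tpq * sqr * spr * x4 + spq * spr * tqr * x5
      + spq * spr * sqr * x6"
    by (simp add: algebra_simps)
  thus ?thesis
    unfolding assms by (simp add: algebra_simps)
qed

lemma act_braid:
  assumes "Suc (Suc k) < length w"
  defines "i \<equiv> Suc k" and "j \<equiv> Suc (Suc k)"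
  shows "act_at i op_T (act_at j op_T (act_at i op_T (of_word w)))
    = act_at j op_T (act_at i op_T (act_at j op_T (of_word w)))"
proof -
  obtain a p q r b where w: "w = a @ p # q # r # b" "length a = k"
    using assms by (elim split_at_three)
  note acts = act_T [OF w(2)] act_T_Suc [OF w(2)]
  show ?thesis
    unfolding w(1) i_def j_def
  proof (rule poly_mapping_eqI, simp only: acts act_linear lookup_add lookup_scale, goal_cases)
    case (1 l)
    show ?case
      \<comment> \<open>In the third identity the letters occur in the order \<open>q\<close>,
        \<open>r\<close>, \<open>p\<close>; all three are taken at the same triple.\<close>
      using coeff_braid(1,2) [of p q r] coeff_braid(3) [of q r p]
      by (rule braid_identity)
  qed
qed

text \<open>\<open>E\<close> reads only the upper labels. If all three agree, it fixes every
  arrangement of the letters. Otherwise \<open>coeff_T\<close> vanishes on pairs with distinct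
  labels, and words in which an \<open>E\<close> meets distinct labels drop out.\<close>

lemma act_adjacent_E:
  assumes "Suc (Suc k) < length w"
    and ij: "i = Suc k \<and> j = Suc (Suc k) \<or> j = Suc k \<and> i = Suc (Suc k)"
  shows "act_at i op_E (act_at j op_E (of_word w)) = act_at j op_E (act_at i op_E (of_word w))"
    and "act_at i op_E (act_at j op_E (act_at i op_T (of_word w)))
      = act_at i op_T (act_at i op_E (act_at j op_E (of_word w)))"
    and "act_at i op_T (act_at i op_E (act_at j op_E (of_word w)))
      = act_at j op_E (act_at i op_T (act_at j op_E (of_word w)))"
    and "act_at i op_E (act_at j op_T (act_at i op_T (of_word w)))
      = act_at j op_T (act_at i op_T (act_at j op_E (of_word w)))"
proof -
  obtain a p q r b where w: "w = a @ p # q # r # b" "length a = k"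
    using assms by (elim split_at_three)
  note acts = act_T [OF w(2)] act_T_Suc [OF w(2)] act_E [OF w(2)] act_E_Suc [OF w(2)]
  note [simp] = acts act_linear w(1)
  note coeffs = coeff_E_def coeff_T_def [of p q] coeff_T_def [of p r] coeff_T_def [of q r]
  consider "i = Suc k" "j = Suc (Suc k)" | "j = Suc k" "i = Suc (Suc k)"
    using ij by blast
  note index_cases = this
  \<comment> \<open>These are the five partitions of three labels into classes of equal
    ones.\<close>
  consider "snd p = snd q" "snd q = snd r" | "snd p = snd q" "snd q \<noteq> snd r" "snd p \<noteq> snd r"
    | "snd p \<noteq> snd q" "snd q = snd r" "snd p \<noteq> snd r"
    | "snd p = snd r" "snd q \<noteq> snd r" "snd p \<noteq> snd q"
    | "snd p \<noteq> snd q" "snd q \<noteq> snd r" "snd p \<noteq> snd r"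
    by metis
  note label_cases = this
  show "act_at i op_E (act_at j op_E (of_word w)) = act_at j op_E (act_at i op_E (of_word w))"
    by (rule index_cases; simp add: mult.commute)
  show "act_at i op_E (act_at j op_E (act_at i op_T (of_word w)))
      = act_at i op_T (act_at i op_E (act_at j op_E (of_word w)))"
    by (rule index_cases; simp; rule label_cases; simp add: coeffs nc.scale_right_distrib)
  show "act_at i op_T (act_at i op_E (act_at j op_E (of_word w)))
      = act_at j op_E (act_at i op_T (act_at j op_E (of_word w)))"
    by (rule index_cases; simp; rule label_cases; simp add: coeffs nc.scale_right_distrib)
  show "act_at i op_E (act_at j op_T (act_at i op_T (of_word w)))
      = act_at j op_T (act_at i op_T (act_at j op_E (of_word w)))"
    by (rule index_cases; simp; rule label_cases; simp add: coeffs nc.scale_right_distrib)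
qed

lemma act_far:
  assumes w: "i \<in> {1..<length w}" "j \<in> {1..<length w}" "far i j"
    and F: "F = op_E \<or> F = op_T" and G: "G = op_E \<or> G = op_T"
  shows "act_at i F (act_at j G (of_word w)) = act_at j G (act_at i F (of_word w))"
proof -
  \<comment> \<open>Positions and operators are quantified, so that the opposite order follows by
    exchanging roles.\<close>
  have less: "act_at i F (act_at j G (of_word w)) = act_at j G (act_at i F (of_word w))"
    if ij: "i \<in> {1..<length w}" "j \<in> {1..<length w}" "i + 1 < j"
      and FG: "F = op_E \<or> F = op_T" "G = op_E \<or> G = op_T" for i j F G
  proof -
    obtain a p q m r s b where ws: "w = a @ p # q # m @ r # s # b" "i = Suc (length a)"
        "j = Suc (length (a @ p # q # m))"
      by (rule split_far [OF ij])
    \<comment> \<open>The rules leave the other pair general and so still apply after the other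
      operator has flipped it.\<close>
    have act_i: "act_at i op_E (of_word (a @ p # q # b)) = scale (coeff_E p q) (of_word (a @ p # q # b))"
      "act_at i op_T (of_word (a @ p # q # b)) = scale (coeff_T p q) (of_word (a @ p # q # b))
        + scale (coeff_swap p q) (of_word (a @ q # p # b))" for p q b
      unfolding ws by (rule act_E act_T, rule refl)+
    have act_j: "act_at j op_E (of_word (a @ p # q # m @ r # s # b))
        = scale (coeff_E r s) (of_word (a @ p # q # m @ r # s # b))"
      "act_at j op_T (of_word (a @ p # q # m @ r # s # b))
        = scale (coeff_T r s) (of_word (a @ p # q # m @ r # s # b))
        + scale (coeff_swap r s) (of_word (a @ p # q # m @ s # r # b))" for p q r s b
      using act_E [of "a @ p # q # m" _ r s b] act_T [of "a @ p # q # m" _ r s b]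
      unfolding ws by simp_all
    show ?thesis
      using FG unfolding ws(1)
      by (elim disjE; simp add: act_i act_j act_linear nc.scale_right_distrib ac_simps)
  qed
  consider "i + 1 < j" | "j + 1 < i" using w(3) by linarith
  thus ?thesis
    using less [of i j F G] less [of j i G F] w F G by cases auto
qed


section \<open>The representation\<close>

primrec bt_action :: "bt_gen \<Rightarrow> (nat \<times> nat) ncpoly \<Rightarrow> (nat \<times> nat) ncpoly" where
  "bt_action (TGen i) = act_at i op_T"
| "bt_action (EGen i) = act_at i op_E"

lemma nc_linear_bt_action: "nc_linear (bt_action g)"
  by (cases g) (simp_all add: nc_linear_act_at)

lemmas extend_bt_mult = extend_rep_mult [of bt_action, OF nc_linear_bt_action]
lemmas extend_bt_add = nc_pair.linear_add [OF nc_linear_extend_rep_left, of bt_action]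
lemmas extend_bt_scale = nc_pair.linear_scale [OF nc_linear_extend_rep_left, of bt_action]

text \<open>\<open>k\<close> counts the factors to the left of the three on which the two generators
  act.\<close>

lemma adjacent_cases:
  assumes "adjacent i j" "i \<in> {1..<n}" "j \<in> {1..<n}"
  obtains k where "Suc (Suc k) < n" "i = Suc k \<and> j = Suc (Suc k) \<or> j = Suc k \<and> i = Suc (Suc k)"
proof -
  have "i = Suc j \<or> j = Suc i" using assms(1) by linarith
  thus ?thesis
  proof
    assume "i = Suc j"
    with assms show ?thesis by (intro that [of "j - 1"]) auto
  next
    assume "j = Suc i"
    with assms show ?thesis by (intro that [of "i - 1"]) auto
  qed
qed

lemma extend_bt_relation_word:
  assumes "(x, y) \<in> bt_relations n" "length w = n"
  shows "extend_rep bt_action x (of_word w) = extend_rep bt_action y (of_word w)"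
proof -
  note ext [simp] = extend_bt_mult extend_bt_add extend_bt_scale power2_eq_square
  from assms(1) show ?thesis
  proof cases
    case (TT_far i j)
    thus ?thesis using act_far [of i w j op_T op_T] assms(2) by simp
  next
    case (TTT i j)
    then obtain k where k: "Suc (Suc k) < n"
      "i = Suc k \<and> j = Suc (Suc k) \<or> j = Suc k \<and> i = Suc (Suc k)"
      by (elim adjacent_cases)
    \<comment> \<open>Exchanging \<open>i\<close> and \<open>j\<close> merely swaps the sides of the
      braid relation, so \<open>act_braid\<close> serves both orders.\<close>
    with TTT show ?thesis using act_braid [of k w] assms(2) by auto
  next
    case (T_square i)
    thus ?thesis using act_T_square [of i w] assms(2) by simp
  next
    case (EE i j)
    consider "i = j" | "adjacent i j" | "far i j" by linarith
    thus ?thesis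
    proof cases
      case 2
      with EE obtain k where k: "Suc (Suc k) < n"
        "i = Suc k \<and> j = Suc (Suc k) \<or> j = Suc k \<and> i = Suc (Suc k)"
        by (elim adjacent_cases)
      with EE show ?thesis using act_adjacent_E(1) [of k w i j] assms(2) by simp
    qed (use EE act_far [of i w j op_E op_E] assms(2) in simp_all)
  next
    case (E_square i)
    then obtain a p q b where w: "w = a @ p # q # b" "length a = i - 1"
      using assms(2) by (auto intro: split_at_two [of "i - 1" w])
    with E_square act_E [OF w(2)] show ?thesis
      by (simp add: act_at_scale coeff_E_def)
  next
    case (ET_far i j)
    thus ?thesis using act_far [of i w j op_E op_T] assms(2) by simp
  next
    case (ET i)
    then obtain a p q b where w: "w = a @ p # q # b" "length a = i - 1"
      using assms(2) by (auto intro: split_at_two [of "i - 1" w])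
    with ET act_E [OF w(2)] act_T [OF w(2)] show ?thesis
      by (simp add: act_at_scale act_at_add coeff_E_def)
  next
    case (EET i j)
    then obtain k where k: "Suc (Suc k) < n"
      "i = Suc k \<and> j = Suc (Suc k) \<or> j = Suc k \<and> i = Suc (Suc k)"
      by (elim adjacent_cases)
    with EET show ?thesis using act_adjacent_E(2) [of k w i j] assms(2) by simp
  next
    case (ETE i j)
    then obtain k where k: "Suc (Suc k) < n"
      "i = Suc k \<and> j = Suc (Suc k) \<or> j = Suc k \<and> i = Suc (Suc k)"
      by (elim adjacent_cases)
    with ETE show ?thesis using act_adjacent_E(3) [of k w i j] assms(2) by simp
  next
    case (ETT i j)
    then obtain k where k: "Suc (Suc k) < n"
      "i = Suc k \<and> j = Suc (Suc k) \<or> j = Suc k \<and> i = Suc (Suc k)"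
      by (elim adjacent_cases)
    with ETT show ?thesis using act_adjacent_E(4) [of k w i j] assms(2) by simp
  qed
qed

lemma extend_bt_relation:
  assumes "(x, y) \<in> bt_relations n" "z \<in> tensor_power B n"
  shows "extend_rep bt_action x z = extend_rep bt_action y z"
proof (rule nc_linear_eqI [where x = z and S = "{w \<in> lists B. length w = n}"])
  show "Poly_Mapping.keys z \<subseteq> {w \<in> lists B. length w = n}"
    using assms(2) by (simp add: tensor_power_def)
qed (use extend_bt_relation_word [OF assms(1)] in
    \<open>auto intro: nc_linear_extend_rep_right nc_linear_bt_action\<close>)

text \<open>The differences of the two sides must lie in the carrier for \<open>Idl\<close> to
  produce an ideal.\<close>

lemma bt_relations_closed:
  assumes "(x, y) \<in> bt_relations n"
  shows "x \<in> carrier (free_algebra (bt_gens n))" "y \<in> carrier (free_algebra (bt_gens n))"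
proof -
  have T: "Poly_Mapping.keys (T i) \<subseteq> lists (bt_gens n)" if "i \<in> {1..<n}" for i
    using that by (simp add: bt_gens_def)
  have E: "Poly_Mapping.keys (E i) \<subseteq> lists (bt_gens n)" if "i \<in> {1..<n}" for i
    using that by (simp add: bt_gens_def)
  have one: "Poly_Mapping.keys (1 :: bt_gen ncpoly) \<subseteq> lists (bt_gens n)"
    by (simp add: zero_list_def)
  from assms have "Poly_Mapping.keys x \<subseteq> lists (bt_gens n) \<and> Poly_Mapping.keys y \<subseteq> lists (bt_gens n)"
    by cases (simp_all only: power2_eq_square keys_mult_lists keys_add_subset keys_scale_subset
        T E one simp_thms)
  thus "x \<in> carrier (free_algebra (bt_gens n))" "y \<in> carrier (free_algebra (bt_gens n))"
    by simp_all
qed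

lemma subspace_tensor_power: "nc.subspace (tensor_power B m)"
  unfolding tensor_power_def by (rule subspace_words)

text \<open>The operators only rescale words and flip two letters, so length and alphabet are
  preserved.\<close>

lemma bt_action_closed:
  assumes g: "g \<in> bt_gens n" and z: "z \<in> tensor_power B n"
  shows "bt_action g z \<in> tensor_power B n"
proof -
  let ?W = "{w \<in> lists B. length w = n}"
  have word: "bt_action g (of_word w) \<in> tensor_power B n" if w: "w \<in> ?W" for w
  proof -
    from g obtain i where i: "i \<in> {1..<n}" "g = TGen i \<or> g = EGen i"
      by (auto simp: bt_gens_def)
    obtain a p q b where w': "w = a @ p # q # b" "length a = i - 1"
      using i w by (auto intro: split_at_two [of "i - 1" w])
    have "of_word (a @ p # q # b) \<in> tensor_power B n" "of_word (a @ q # p # b) \<in> tensor_power B n"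
      using w w' by (auto simp: tensor_power_def)
    with i act_E [OF w'(2), of p q b] act_T [OF w'(2), of p q b] show ?thesis
      unfolding w'(1)
      by (auto intro!: nc.subspace_add nc.subspace_scale subspace_tensor_power)
  qed
  have "z \<in> nc.span (of_word ` ?W)"
    using z by (simp add: tensor_power_def keys_subset_iff_span)
  thus ?thesis
  proof (induction rule: nc.span_induct_alt)
    case base
    show ?case
      using nc_pair.linear_0 [OF nc_linear_bt_action] nc.subspace_0 [OF subspace_tensor_power]
      by simp
  next
    case (step c x y)
    thus ?case using word
      by (auto simp: nc_pair.linear_add [OF nc_linear_bt_action]
          nc_pair.linear_scale [OF nc_linear_bt_action]
          intro!: nc.subspace_add nc.subspace_scale subspace_tensor_power)
  qed
qed

theorem theorem3p1:
  fixes n :: nat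
  assumes "n \<ge> 2"
  shows "\<exists>!J. J \<in> algebra_hom (bt_algebra n) (End_algebra (tensor_power (V_basis n) n))
                \<inter> extensional (carrier (bt_algebra n))
           \<and> (\<forall>i\<in>{1..n - 1}. J (bt_E n i) = at_factors n i op_E
                              \<and> J (bt_T n i) = at_factors n i op_T)"
proof -
  let ?A = "free_algebra (bt_gens n)" and ?W = "tensor_power (V_basis n) n"
  let ?B = "End_algebra ?W" and ?R = "{x - y | x y. (x, y) \<in> bt_relations n}"
  define \<Phi> where "\<Phi> = (\<lambda>x. restrict (extend_rep bt_action x) ?W)"
  interpret A: ring ?A by (rule ring_free_algebra)
  have B: "ring ?B" by (intro ring_End_algebra subspace_tensor_power)
  have R: "?R \<subseteq> carrier ?A"
    using bt_relations_closed nc.subspace_diff [OF subspace_words [of "lists (bt_gens n)"]]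
    by fastforce
  have \<Phi>: "\<Phi> \<in> algebra_hom ?A ?B"
    unfolding \<Phi>_def
    by (intro extend_rep_algebra_hom nc_linear_bt_action subspace_tensor_power bt_action_closed)
  interpret \<Phi>: ring_hom_ring ?A ?B \<Phi>
    using \<Phi> by (intro ring_hom_ringI2 ring_free_algebra B) (simp add: algebra_hom_def)
  have "?R \<subseteq> a_kernel ?A ?B \<Phi>"
    using R extend_bt_relation
    by (auto simp: a_kernel_def' \<Phi>_def fun_eq_iff
        nc_pair.linear_diff [OF nc_linear_extend_rep_left])
  \<comment> \<open>The kernel is an ideal containing the generating differences, hence contains the
    smallest such ideal.\<close>
  hence "bt_ideal n \<subseteq> a_kernel ?A ?B \<Phi>"
    unfolding bt_ideal_def by (intro A.genideal_minimal \<Phi>.kernel_is_ideal)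
  hence ker: "\<Phi> x = \<zero>\<^bsub>?B\<^esub>" if "x \<in> bt_ideal n" for x
    using that by (blast intro: \<Phi>.kernel_zero)
  have I: "ideal (bt_ideal n) ?A"
    unfolding bt_ideal_def using R by (rule A.genideal_ideal)
  have \<Phi>_gen: "\<Phi> (E i) = at_factors n i op_E" "\<Phi> (T i) = at_factors n i op_T" for i
    by (simp_all add: \<Phi>_def at_factors_eq fun_eq_iff)
  \<comment> \<open>The range \<open>{1..n - 1}\<close> matches \<open>{1..<n}\<close> in
    \<open>bt_gens\<close>, so the prescribed values cover every letter.\<close>
  have gens: "g \<in> bt_gens n \<longleftrightarrow> (\<exists>i\<in>{1..n - 1}. g = EGen i \<or> g = TGen i)" for g
    using assms by (auto simp: bt_gens_def)
  show ?thesis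
  proof (rule ex_ex1I)
    obtain J where "J \<in> algebra_hom (bt_algebra n) ?B \<inter> extensional (carrier (bt_algebra n))"
      and J: "\<And>x. x \<in> carrier ?A \<Longrightarrow> J (bt_ideal n +>\<^bsub>?A\<^esub> x) = \<Phi> x"
      using quotient_universal [OF I \<Phi> B ker] unfolding bt_algebra_def by blast
    moreover have "T i \<in> carrier ?A" "E i \<in> carrier ?A" if "i \<in> {1..n - 1}" for i
      using that gens by auto
    ultimately show "\<exists>J. J \<in> algebra_hom (bt_algebra n) ?B \<inter> extensional (carrier (bt_algebra n))
        \<and> (\<forall>i\<in>{1..n - 1}. J (bt_E n i) = at_factors n i op_E
                          \<and> J (bt_T n i) = at_factors n i op_T)"
      by (intro exI [of _ J]) (simp add: bt_E_def bt_T_def \<Phi>_gen)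
  next
    fix J J'
    assume "J \<in> algebra_hom (bt_algebra n) ?B \<inter> extensional (carrier (bt_algebra n))
        \<and> (\<forall>i\<in>{1..n - 1}. J (bt_E n i) = at_factors n i op_E
                          \<and> J (bt_T n i) = at_factors n i op_T)"
      and "J' \<in> algebra_hom (bt_algebra n) ?B \<inter> extensional (carrier (bt_algebra n))
        \<and> (\<forall>i\<in>{1..n - 1}. J' (bt_E n i) = at_factors n i op_E
                          \<and> J' (bt_T n i) = at_factors n i op_T)"
    thus "J = J'"
      unfolding bt_algebra_def
      by (intro quotient_hom_eqI [OF I]) (auto simp: gens bt_E_def bt_T_def)
  qed
qed

end
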